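(* Let $J\in\mathbb{R}^{3\times 3}$ be the (symmetric positive-definite) inertia matrix, let $R_d(t)\in\mathsf{SO(3)}$ be a smooth attitude command with angular velocity $\Omega_d(t)$ given by $\hat\Omega_d=R_d^T\dot R_d$, and consider the attitude dynamics $$\dot R=R\hat\Omega,\qquad J\dot\Omega+\Omega\times J\Omega=M,$$ with $R\in\mathsf{SO(3)}$, $\Omega\in\mathbb{R}^3$, under the control moment $$M=-k_Re_R-k_\Omega e_\Omega+\Omega\times J\Omega-J(\hat\Omega R^TR_d\Omega_d-R^TR_d\dot\Omega_d),$$ for any positive constants $k_R,k_\Omega$, where $e_R=\frac12(R_d^TR-R^TR_d)^\vee$, $e_\Omega=\Omega-R^TR_d\Omega_d$, and $\Psi(R,R_d)=\frac12\mathrm{tr}[I-R_d^TR]$. Suppose that the initial conditions satisfy $$\Psi(R(0),R_d(0))<2,\qquad \|e_\Omega(0)\|^2<\frac{2}{\lambda_M(J)}\,k_R\,\bigl(2-\Psi(R(0),R_d(0))\bigr).$$ Then the zero equilibrium of the closed loop tracking error $(e_R,e_\Omega)=(0,0)$ is exponentially stable. Furthermore, there exist constants $\alpha_2,\beta_2>0$ such that $$\Psi(R(t),R_d(t))\le\min\{2,\ \alpha_2e^{-\beta_2t}\}$$ (for all $t\ge 0$).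
   Context: $\mathsf{SO(3)}=\{R\in\mathbb{R}^{3\times3}\mid R^TR=I,\ \det R=1\}$. The hat map $\hat{\cdot}:\mathbb{R}^3\to\mathfrak{so}(3)$ (skew-symmetric $3\times3$ matrices) is defined by $\hat xy=x\times y$ for all $x,y\in\mathbb{R}^3$; the vee map $^\vee:\mathfrak{so}(3)\to\mathbb{R}^3$ is its inverse. $\lambda_m(\cdot)$ and $\lambda_M(\cdot)$ denote the minimum and maximum eigenvalues of a matrix. $R$ is the rotation matrix from the body-fixed frame to the inertial frame of a quadrotor UAV, $\Omega$ its angular velocity in the body-fixed frame, $J$ its inertia matrix in the body-fixed frame, and $M\in\mathbb{R}^3$ the control moment in the body-fixed frame. Exponential stability of the zero equilibrium of an error variable $z$ refers to a bound of the form $\|z(t)\|\le\alpha\|z(0)\|e^{-\beta t}$ for all $t>0$, with constants $\alpha,\beta>0$; the conditions on the initial values describe a region of attraction. Here $z=(e_R,e_\Omega)$. *)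

theory Defs
  imports "HOL-Analysis.Analysis"
begin

unbundle cross3_syntax

definition SO3 :: "(real^3^3) set" where
  "SO3 = {R. transpose R ** R = mat 1 \<and> det R = 1}"

definition hat :: "real^3 \<Rightarrow> real^3^3" where
  "hat x = matrix (\<lambda>y. x \<times> y)"

text \<open>The range of \<^const>\<open>hat\<close> is the set of skew-symmetric matrices; off that set the value of
  \<open>vee\<close> is unspecified.\<close>

definition vee :: "real^3^3 \<Rightarrow> real^3" where
  "vee = inv hat"

lemma hat_component:
  "hat x = vector [vector [0, - x$3, x$2], vector [x$3, 0, - x$1], vector [- x$2, x$1, 0]]"
  by (simp add: hat_def matrix_def cross3_def vec_eq_iff forall_3 axis_def)

lemma hat_mult_vec: "hat x *v y = x \<times> y"
  by (simp add: hat_component matrix_vector_mult_def cross3_def vec_eq_iff forall_3 sum_3)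

lemma inj_hat: "inj hat"
  by (rule injI) (simp add: hat_component vec_eq_iff forall_3)

lemma vee_hat: "vee (hat x) = x"
  by (simp add: vee_def inj_hat)

lemma transpose_hat: "transpose (hat x) = - hat x"
  by (simp add: hat_component transpose_def vec_eq_iff forall_3)

lemma hat_vee:
  assumes "transpose A = - A"
  shows "hat (vee A) = A"
proof -
  have skew: "A $ j $ i = - (A $ i $ j)" for i j
  proof -
    have "A $ j $ i = transpose A $ i $ j"
      by (simp only: transpose_def vec_lambda_beta)
    then show ?thesis
      by (simp only: assms vector_uminus_component)
  qed
  have diag: "A $ i $ i = 0" for i
    using skew[of i i] by linarith
  have "hat (vector [A$3$2, A$1$3, A$2$1]) = A"
    by (simp add: hat_component vec_eq_iff forall_3 diag skew[of 1 2] skew[of 2 3] skew[of 3 1])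
  then show ?thesis
    by (metis vee_hat)
qed

definition sym_pos_def :: "real^'n^'n \<Rightarrow> bool" where
  "sym_pos_def A \<longleftrightarrow> transpose A = A \<and> (\<forall>x. x \<noteq> 0 \<longrightarrow> 0 < x \<bullet> (A *v x))"

text \<open>Used only for symmetric matrices, which have a nonempty finite set of real eigenvalues.\<close>

definition lambda_max :: "real^'n^'n \<Rightarrow> real" where
  "lambda_max A = Max {l. \<exists>v. v \<noteq> 0 \<and> A *v v = l *\<^sub>R v}"

text \<open>The time domain is \<open>{0..}\<close>; derivatives at time \<open>0\<close> are one-sided.\<close>

abbreviation time_deriv :: "(real \<Rightarrow> 'a::real_normed_vector) \<Rightarrow> real \<Rightarrow> 'a" where
  "time_deriv f t \<equiv> vector_derivative f (at t within {0..})"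

text \<open>\<open>D n\<close> is the \<open>n\<close>-th derivative of \<open>f\<close>.\<close>

definition smooth_in_time :: "(real \<Rightarrow> 'a::real_normed_vector) \<Rightarrow> bool" where
  "smooth_in_time f \<longleftrightarrow> (\<exists>D. (\<forall>t\<ge>0. D 0 t = f t) \<and>
     (\<forall>n::nat. \<forall>t\<ge>0. (D n has_vector_derivative D (Suc n) t) (at t within {0..})))"

definition attitude_command :: "(real \<Rightarrow> real^3^3) \<Rightarrow> (real \<Rightarrow> real^3) \<Rightarrow> bool" where
  "attitude_command Rd \<Omega>d \<longleftrightarrow> smooth_in_time Rd \<and>
     (\<forall>t\<ge>0. Rd t \<in> SO3 \<and> hat (\<Omega>d t) = transpose (Rd t) ** time_deriv Rd t)"

definition attitude_dynamics ::
  "real^3^3 \<Rightarrow> (real \<Rightarrow> real^3) \<Rightarrow> (real \<Rightarrow> real^3^3) \<Rightarrow> (real \<Rightarrow> real^3) \<Rightarrow> bool" where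
  "attitude_dynamics J M R \<Omega> \<longleftrightarrow> (\<forall>t\<ge>0. R t \<in> SO3 \<and>
     (R has_vector_derivative R t ** hat (\<Omega> t)) (at t within {0..}) \<and>
     \<Omega> differentiable (at t within {0..}) \<and>
     J *v time_deriv \<Omega> t + \<Omega> t \<times> (J *v \<Omega> t) = M t)"

definition e_R :: "real^3^3 \<Rightarrow> real^3^3 \<Rightarrow> real^3" where
  "e_R R Rd = (1/2) *\<^sub>R vee (transpose Rd ** R - transpose R ** Rd)"

definition e_\<Omega> :: "real^3^3 \<Rightarrow> real^3 \<Rightarrow> real^3^3 \<Rightarrow> real^3 \<Rightarrow> real^3" where
  "e_\<Omega> R \<Omega> Rd \<Omega>d = \<Omega> - (transpose R ** Rd) *v \<Omega>d"

definition \<Psi> :: "real^3^3 \<Rightarrow> real^3^3 \<Rightarrow> real" where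
  "\<Psi> R Rd = (1/2) * trace (mat 1 - transpose Rd ** R)"

text \<open>The last argument \<open>\<alpha>d\<close> is the time derivative of \<open>\<Omega>d\<close>.\<close>

definition control_moment ::
  "real^3^3 \<Rightarrow> real \<Rightarrow> real \<Rightarrow> real^3^3 \<Rightarrow> real^3 \<Rightarrow> real^3^3 \<Rightarrow> real^3 \<Rightarrow> real^3 \<Rightarrow> real^3" where
  "control_moment J k\<^sub>R k\<^sub>\<Omega> R \<Omega> Rd \<Omega>d \<alpha>d =
     - k\<^sub>R *\<^sub>R e_R R Rd - k\<^sub>\<Omega> *\<^sub>R e_\<Omega> R \<Omega> Rd \<Omega>d + \<Omega> \<times> (J *v \<Omega>)
     - J *v ((hat \<Omega> ** transpose R ** Rd) *v \<Omega>d - (transpose R ** Rd) *v \<alpha>d)"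

definition closed_loop ::
  "real^3^3 \<Rightarrow> real \<Rightarrow> real \<Rightarrow> (real \<Rightarrow> real^3^3) \<Rightarrow> (real \<Rightarrow> real^3) \<Rightarrow>
   (real \<Rightarrow> real^3^3) \<Rightarrow> (real \<Rightarrow> real^3) \<Rightarrow> bool" where
  "closed_loop J k\<^sub>R k\<^sub>\<Omega> Rd \<Omega>d R \<Omega> \<longleftrightarrow>
     attitude_dynamics J
       (\<lambda>t. control_moment J k\<^sub>R k\<^sub>\<Omega> (R t) (\<Omega> t) (Rd t) (\<Omega>d t) (time_deriv \<Omega>d t)) R \<Omega>"

definition initial_region ::
  "real^3^3 \<Rightarrow> real \<Rightarrow> real^3^3 \<Rightarrow> real^3 \<Rightarrow> ((real^3^3) \<times> (real^3)) set" where
  "initial_region J k\<^sub>R Rd0 \<Omega>d0 = {(R0, \<Omega>0). R0 \<in> SO3 \<and> \<Psi> R0 Rd0 < 2 \<and>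
     (norm (e_\<Omega> R0 \<Omega>0 Rd0 \<Omega>d0))\<^sup>2 < 2 / lambda_max J * k\<^sub>R * (2 - \<Psi> R0 Rd0)}"

text \<open>The constants in the exponential bounds are uniform on compact sets \<open>K\<close> of initial states
  inside the region of attraction (a single initial state is a special case). In \<open>exp_stable\<close> they
  cannot be uniform on the whole region: the error vector \<open>z\<close> also becomes arbitrarily small near
  the boundary points with \<^term>\<open>\<Psi> R0 Rd0 = 2\<close>, where \<^const>\<open>e_R\<close> vanishes too.\<close>

definition exp_stable ::
  "real^3^3 \<Rightarrow> real \<Rightarrow> real \<Rightarrow> (real \<Rightarrow> real^3^3) \<Rightarrow> (real \<Rightarrow> real^3) \<Rightarrow>
   ((real^3^3) \<times> (real^3)) set \<Rightarrow> bool" where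
  "exp_stable J k\<^sub>R k\<^sub>\<Omega> Rd \<Omega>d D \<longleftrightarrow>
     (\<forall>K. compact K \<and> K \<subseteq> D \<longrightarrow>
       (\<exists>\<alpha>>0. \<exists>\<beta>>0. \<forall>R \<Omega>. closed_loop J k\<^sub>R k\<^sub>\<Omega> Rd \<Omega>d R \<Omega> \<and> (R 0, \<Omega> 0) \<in> K \<longrightarrow>
         (let z = (\<lambda>t. (e_R (R t) (Rd t), e_\<Omega> (R t) (\<Omega> t) (Rd t) (\<Omega>d t)))
          in \<forall>t>0. norm (z t) \<le> \<alpha> * norm (z 0) * exp (- \<beta> * t))))"

end

theory Submission
  imports Defs
begin

text \<open>The relative attitude \<open>E = R\<^sub>d\<^sup>T R\<close> and \<open>e = e\<^sub>\<Omega>\<close> satisfy the autonomous system \<open>E' = E (hat e)\<close>,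
  \<open>J e' = - k\<^sub>R r - k\<^sub>\<Omega> e\<close> with \<open>r = e\<^sub>R\<close>, and \<open>\<Psi>' = r \<cdot> e\<close>. Hence \<open>e \<cdot> J e / 2 + k\<^sub>R \<Psi>\<close> decreases with rate
  \<open>k\<^sub>\<Omega> |e|\<^sup>2\<close>; the initial conditions bound it by \<open>k\<^sub>R \<psi>\<close> with \<open>\<psi> < 2\<close>, so \<open>\<Psi> \<le> \<psi>\<close> for all times. Since
  \<open>|r|\<^sup>2 = \<Psi> (2 - \<Psi>)\<close>, on this sublevel set \<open>\<Psi>\<close> is comparable to \<open>|r|\<^sup>2\<close>, and adding a small multiple of
  \<open>r \<cdot> J e\<close> gives a strict Lyapunov function comparable to \<open>|r|\<^sup>2 + |e|\<^sup>2\<close>.\<close>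

section \<open>Symmetric matrices\<close>

lemma bounded_bilinear_matrix_vector_mult:
  "bounded_bilinear ((*v) :: real^'n^'m \<Rightarrow> real^'n \<Rightarrow> real^'m)"
  by (auto simp: bilinear_conv_bounded_bilinear[symmetric] bilinear_def intro!: linearI
    matrix_vector_mult_add_rdistrib matrix_vector_right_distrib matrix_vector_mult_scaleR
    scaleR_matrix_vector_assoc[symmetric])

lemma bounded_bilinear_matrix_matrix_mult:
  "bounded_bilinear ((**) :: real^'n^'m \<Rightarrow> real^'k^'n \<Rightarrow> real^'k^'m)"
  by (auto simp: bilinear_conv_bounded_bilinear[symmetric] bilinear_def matrix_matrix_mult_def
    vec_eq_iff sum.distrib algebra_simps sum_distrib_left intro!: linearI)

lemma bounded_linear_transpose: "bounded_linear (transpose :: real^'n^'m \<Rightarrow> real^'m^'n)"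
  by (auto simp: linear_conv_bounded_linear[symmetric] transpose_def vec_eq_iff intro!: linearI)

section \<open>Quadratic forms and eigenvalues of symmetric matrices\<close>

lemma inner_matrix_vector_transpose:
  fixes A :: "real^'n^'m"
  shows "x \<bullet> (A *v y) = (transpose A *v x) \<bullet> y"
  by (simp add: dot_lmul_matrix[symmetric])

lemma inner_symmetric_matrix:
  fixes A :: "real^'n^'n"
  assumes "transpose A = A"
  shows "x \<bullet> (A *v y) = y \<bullet> (A *v x)"
  by (metis assms inner_commute inner_matrix_vector_transpose)

text \<open>Eigenvectors for distinct eigenvalues are orthogonal, and a pairwise orthogonal set in
  finite dimension is finite. This makes the \<open>Max\<close> in \<open>lambda_max\<close>
  meaningful.\<close>

lemma finite_eigenvalues_symmetric:
  fixes A :: "real^'n^'n"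
  assumes "transpose A = A"
  shows "finite {l. \<exists>v. v \<noteq> 0 \<and> A *v v = l *\<^sub>R v}" (is "finite ?S")
proof -
  have "\<forall>l\<in>?S. \<exists>v. v \<noteq> 0 \<and> A *v v = l *\<^sub>R v"
    by blast
  from bchoice[OF this] obtain v where v: "\<And>l. l \<in> ?S \<Longrightarrow> v l \<noteq> 0 \<and> A *v v l = l *\<^sub>R v l"
    by blast
  have orth: "v k \<bullet> v l = 0" if "k \<in> ?S" "l \<in> ?S" "k \<noteq> l" for k l
    using inner_symmetric_matrix[OF assms, of "v k" "v l"] v[OF that(1)] v[OF that(2)] that(3)
    by (simp add: inner_commute)
  have "finite (v ` ?S)"
    by (rule pairwise_orthogonal_imp_finite) (auto simp: pairwise_def orthogonal_def intro: orth)
  moreover have "inj_on v ?S"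
  proof (rule inj_onI, rule ccontr)
    fix k l
    assume "k \<in> ?S" "l \<in> ?S" "v k = v l" "k \<noteq> l"
    then show False
      using orth[of k l] v[of l] by simp
  qed
  ultimately show ?thesis
    by (rule finite_imageD)
qed

text \<open>The form is continuous on the compact unit sphere; homogeneity of degree two carries the
  extremal values to all vectors.\<close>

lemma quadratic_form_attains:
  fixes A :: "real^'n^'n"
  obtains v w where "norm v = 1" "norm w = 1"
    "\<And>x. (v \<bullet> (A *v v)) * (norm x)\<^sup>2 \<le> x \<bullet> (A *v x)"
    "\<And>x. x \<bullet> (A *v x) \<le> (w \<bullet> (A *v w)) * (norm x)\<^sup>2"
proof -
  let ?q = "\<lambda>x. x \<bullet> (A *v x)"
  let ?S = "sphere (0 :: real^'n) 1"
  have cont: "continuous_on ?S ?q"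
    by (intro continuous_intros matrix_vector_mult_linear_continuous_on)
  have ne: "?S \<noteq> {}"
    by simp
  obtain v where v: "v \<in> ?S" "\<And>x. x \<in> ?S \<Longrightarrow> ?q v \<le> ?q x"
    using continuous_attains_inf[OF compact_sphere ne cont] by blast
  obtain w where w: "w \<in> ?S" "\<And>x. x \<in> ?S \<Longrightarrow> ?q x \<le> ?q w"
    using continuous_attains_sup[OF compact_sphere ne cont] by blast
  have scale: "?q x = ?q (x /\<^sub>R norm x) * (norm x)\<^sup>2" "x /\<^sub>R norm x \<in> ?S" if "x \<noteq> 0" for x
  proof -
    have "norm x \<noteq> 0"
      using that by simp
    then show "?q x = ?q (x /\<^sub>R norm x) * (norm x)\<^sup>2" "x /\<^sub>R norm x \<in> ?S"
      by (simp_all add: matrix_vector_mult_scaleR power2_eq_square field_simps)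
  qed
  have "?q v * (norm x)\<^sup>2 \<le> ?q x \<and> ?q x \<le> ?q w * (norm x)\<^sup>2" for x
  proof (cases "x = 0")
    case False
    show ?thesis
      unfolding scale(1)[OF False]
      using v(2)[OF scale(2)[OF False]] w(2)[OF scale(2)[OF False]]
      by (simp add: mult_right_mono)
  qed simp
  then show thesis
    using that v(1) w(1) by auto
qed

text \<open>The maximum of the Rayleigh quotient is itself an eigenvalue, hence at most the largest
  one.\<close>

lemma quadratic_form_le_lambda_max:
  fixes A :: "real^'n^'n"
  assumes sym: "transpose A = A"
  shows "x \<bullet> (A *v x) \<le> lambda_max A * (norm x)\<^sup>2"
proof -
  obtain w where w: "norm w = 1" and max: "\<And>x. x \<bullet> (A *v x) \<le> (w \<bullet> (A *v w)) * (norm x)\<^sup>2"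
    using quadratic_form_attains[of A] by metis
  define m where "m = w \<bullet> (A *v w)"
  \<comment> \<open>\<open>m I - A\<close> is positive semidefinite and its quadratic form vanishes at the maximizer, so \<open>u\<close>,
    its value there, is zero: otherwise moving the maximizer along \<open>u\<close> would increase the form.\<close>
  define u where "u = m *\<^sub>R w - A *v w"
  have pos: "0 \<le> m * (norm y)\<^sup>2 - y \<bullet> (A *v y)" for y
    using max[of y] by (simp add: m_def)
  have ww: "w \<bullet> w = 1"
    using w by (simp add: dot_square_norm)
  have quad: "0 \<le> 2 * s * (u \<bullet> u) + s\<^sup>2 * (m * (u \<bullet> u) - u \<bullet> (A *v u))" for s
  proof -
    have "m * (norm (w + s *\<^sub>R u))\<^sup>2 - (w + s *\<^sub>R u) \<bullet> (A *v (w + s *\<^sub>R u)) =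
      m * (w \<bullet> w) - w \<bullet> (A *v w) + 2 * s * (m * (u \<bullet> w) - u \<bullet> (A *v w))
        + s\<^sup>2 * (m * (u \<bullet> u) - u \<bullet> (A *v u))"
      using inner_symmetric_matrix[OF sym, of w u] unfolding power2_norm_eq_inner
      by (simp add: inner_add_left inner_add_right
        matrix_vector_right_distrib matrix_vector_mult_scaleR inner_commute[of w u]
        power2_eq_square algebra_simps)
    also have "m * (u \<bullet> w) - u \<bullet> (A *v w) = u \<bullet> u"
      by (simp add: u_def inner_diff_right)
    finally show ?thesis
      using pos[of "w + s *\<^sub>R u"] ww by (simp add: m_def)
  qed
  have "u \<bullet> u = 0"
  proof (rule ccontr)
    assume "u \<bullet> u \<noteq> 0"
    then have uu: "0 < u \<bullet> u"
      by simp
    define b where "b = m * (u \<bullet> u) - u \<bullet> (A *v u)"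
    have b: "0 \<le> b"
      using pos[of u] by (simp add: b_def dot_square_norm)
    \<comment> \<open>Up to the \<open>+ 1\<close>, this minimizes the quadratic in
      \<open>quad\<close>; the \<open>+ 1\<close> keeps the denominator positive when
      \<open>b = 0\<close> and still gives \<open>- s * b \<le> u \<bullet> u\<close>.\<close>
    define s where "s = - (u \<bullet> u) / (b + 1)"
    have "0 \<le> s * (2 * (u \<bullet> u) + s * b)"
      using quad[of s] by (simp add: b_def power2_eq_square algebra_simps)
    moreover have "s < 0"
      using uu b by (simp add: s_def)
    ultimately have "2 * (u \<bullet> u) + s * b \<le> 0"
      by (simp add: zero_le_mult_iff)
    moreover have "- s * b \<le> u \<bullet> u"
      using uu b by (simp add: s_def field_simps)
    ultimately show False
      using uu by simp
  qed
  then have "A *v w = m *\<^sub>R w"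
    by (simp add: u_def)
  then have "m \<in> {l. \<exists>v. v \<noteq> 0 \<and> A *v v = l *\<^sub>R v}"
    using w by (auto intro!: exI[of _ w])
  then have "m \<le> lambda_max A"
    unfolding lambda_max_def by (intro Max_ge finite_eigenvalues_symmetric sym)
  then have "m * (norm x)\<^sup>2 \<le> lambda_max A * (norm x)\<^sup>2"
    by (simp add: mult_right_mono)
  then show ?thesis
    using max[of x] by (simp add: m_def)
qed

text \<open>The minimum over the unit sphere is attained, so pointwise positivity becomes uniform.
  The constant takes the place of the smallest eigenvalue.\<close>

lemma sym_pos_def_lower_bound:
  assumes "sym_pos_def A"
  obtains \<mu> where "\<mu> > 0" "\<And>x. \<mu> * (norm x)\<^sup>2 \<le> x \<bullet> (A *v x)"
proof -
  obtain v where v: "norm v = 1" "\<And>x. (v \<bullet> (A *v v)) * (norm x)\<^sup>2 \<le> x \<bullet> (A *v x)"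
    using quadratic_form_attains[of A] by metis
  have "v \<noteq> 0"
    using v(1) by auto
  then have "v \<bullet> (A *v v) > 0"
    using assms by (simp add: sym_pos_def_def)
  then show thesis
    using v(2) by (rule that)
qed

section \<open>Rotations\<close>

text \<open>This is \<open>vee\<close> of the skew part \<open>(E - transpose E) / 2\<close>, in
  coordinates so that it is linear on all matrices.\<close>

definition axial :: "real^3^3 \<Rightarrow> real^3" where
  "axial E = (1/2) *\<^sub>R vector [E$3$2 - E$2$3, E$1$3 - E$3$1, E$2$1 - E$1$2]"

text \<open>For a rotation by the angle theta this is 1 - cos theta.\<close>

definition rot_dist :: "real^3^3 \<Rightarrow> real" where
  "rot_dist E = (3 - trace E) / 2"

lemma e_R_eq_axial: "e_R R Rd = axial (transpose Rd ** R)"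
proof -
  define E where "E = transpose Rd ** R"
  have "transpose Rd ** R - transpose R ** Rd = hat (2 *\<^sub>R axial E)"
    unfolding E_def
    by (simp add: hat_component axial_def vec_eq_iff forall_3 matrix_matrix_mult_def transpose_def
      sum_3 mult.commute)
  then show ?thesis
    by (simp add: e_R_def vee_hat E_def)
qed

lemma \<Psi>_eq_rot_dist: "\<Psi> R Rd = rot_dist (transpose Rd ** R)"
  by (simp add: \<Psi>_def rot_dist_def trace_sub trace_I)

lemma bounded_linear_axial: "bounded_linear axial"
  by (auto simp: linear_conv_bounded_linear[symmetric] axial_def vec_eq_iff forall_3
    algebra_simps intro!: linearI)

lemma bounded_linear_trace: "bounded_linear (trace :: real^'n^'n \<Rightarrow> real)"
  by (auto simp: linear_conv_bounded_linear[symmetric] trace_def sum.distrib sum_distrib_left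
    intro!: linearI)

text \<open>Along \<open>E' = E (hat w)\<close> this is the velocity of
  \<open>axial E\<close>.\<close>

lemma axial_mult_hat: "axial (E ** hat w) = (1/2) *\<^sub>R (trace E *\<^sub>R w - transpose E *v w)"
  by (simp add: axial_def hat_component trace_def vec_eq_iff forall_3 matrix_matrix_mult_def
    matrix_vector_mult_def transpose_def sum_3 field_simps)

text \<open>Only the skew part of \<open>E\<close> contributes to the trace against a skew matrix.
  This identity gives the rate of \<open>rot_dist\<close> along the error dynamics.\<close>

lemma trace_mult_hat: "trace (E ** hat w) = - 2 * (axial E \<bullet> w)"
  by (simp add: axial_def hat_component trace_def matrix_matrix_mult_def inner_vec_def sum_3
    field_simps)

lemma SO3_mult: "A \<in> SO3 \<Longrightarrow> B \<in> SO3 \<Longrightarrow> A ** B \<in> SO3"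
  by (auto simp: SO3_def det_mul matrix_transpose_mul)
    (metis matrix_mul_assoc matrix_mul_lid)

lemma SO3_transpose: "A \<in> SO3 \<Longrightarrow> transpose A \<in> SO3"
  by (simp add: SO3_def matrix_left_right_inverse)

lemma SO3_mult_transpose: "A \<in> SO3 \<Longrightarrow> A ** transpose A = mat 1"
  using SO3_transpose[of A] by (simp add: SO3_def)

lemma norm_SO3_mult: "A \<in> SO3 \<Longrightarrow> norm (A *v x) = norm x"
  by (simp add: norm_eq_sqrt_inner inner_matrix_vector_transpose[of "A *v x"] SO3_def
    matrix_vector_mul_assoc)

lemma SO3_cross: "A \<in> SO3 \<Longrightarrow> (A *v x) \<times> (A *v y) = A *v (x \<times> y)"
  by (simp add: SO3_def cross_orthogonal_matrix orthogonal_matrix)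

text \<open>Rotations preserve cross products; both sides are compared on an arbitrary
  vector.\<close>

lemma SO3_conj_hat:
  assumes "A \<in> SO3"
  shows "transpose A ** hat x ** A = hat (transpose A *v x)"
proof -
  have "(transpose A ** hat x ** A) *v y = hat (transpose A *v x) *v y" for y
  proof -
    have "(transpose A ** hat x ** A) *v y = transpose A *v (x \<times> (A *v y))"
      by (simp only: matrix_vector_mul_assoc[symmetric] hat_mult_vec)
    also have "\<dots> = (transpose A *v x) \<times> (transpose A *v (A *v y))"
      by (rule SO3_cross[OF SO3_transpose[OF assms], symmetric])
    also have "transpose A *v (A *v y) = y"
      using assms by (simp add: matrix_vector_mul_assoc SO3_def del: vector_transpose_matrix)
    finally show ?thesis
      by (simp only: hat_mult_vec)
  qed
  then show ?thesis
    by (simp add: matrix_eq)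
qed

text \<open>For a rotation by the angle \<open>\<theta>\<close> this is \<open>sin\<^sup>2 \<theta> = (1 - cos \<theta>) (1 + cos \<theta>)\<close>. It is proved from
  \<open>4 |axial E|\<^sup>2 = 3 - tr E\<^sup>2\<close> and \<open>tr E\<^sup>2 = (tr E)\<^sup>2 - 2 tr (cof E)\<close>, where \<open>cof E = E\<close>.\<close>

lemma norm_axial_SO3:
  assumes "E \<in> SO3"
  shows "(norm (axial E))\<^sup>2 = rot_dist E * (2 - rot_dist E)"
proof -
  \<comment> \<open>The columns form a positively oriented orthonormal frame, so each is the cross
    product of the next two. The diagonal entries of these identities are the principal 2 by 2
    minors.\<close>
  have cof: "(E *v axis 2 1) \<times> (E *v axis 3 1) = E *v axis 1 1"
    "(E *v axis 3 1) \<times> (E *v axis 1 1) = E *v axis 2 1"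
    "(E *v axis 1 1) \<times> (E *v axis 2 1) = E *v axis 3 1"
    by (simp_all add: SO3_cross[OF assms] cross_basis)
  have 1: "E$1$1 = E$2$2 * E$3$3 - E$3$2 * E$2$3"
    using arg_cong[OF cof(1), of "\<lambda>x. x $ 1"]
    by (simp add: cross3_def matrix_vector_mult_basis column_def)
  have 2: "E$2$2 = E$3$3 * E$1$1 - E$1$3 * E$3$1"
    using arg_cong[OF cof(2), of "\<lambda>x. x $ 2"]
    by (simp add: cross3_def matrix_vector_mult_basis column_def)
  have 3: "E$3$3 = E$1$1 * E$2$2 - E$2$1 * E$1$2"
    using arg_cong[OF cof(3), of "\<lambda>x. x $ 3"]
    by (simp add: cross3_def matrix_vector_mult_basis column_def)
  have "trace (transpose E ** E) = 3"
    using assms by (simp add: SO3_def trace_I)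
  then have n: "(E$1$1)\<^sup>2 + (E$2$1)\<^sup>2 + (E$3$1)\<^sup>2 + ((E$1$2)\<^sup>2 + (E$2$2)\<^sup>2 + (E$3$2)\<^sup>2)
     + ((E$1$3)\<^sup>2 + (E$2$3)\<^sup>2 + (E$3$3)\<^sup>2) = 3"
    by (simp add: trace_def matrix_matrix_mult_def transpose_def sum_3 power2_eq_square)
  have "4 * (norm (axial E))\<^sup>2 =
    (E$3$2 - E$2$3)\<^sup>2 + (E$1$3 - E$3$1)\<^sup>2 + (E$2$1 - E$1$2)\<^sup>2"
    unfolding power2_norm_eq_inner
    by (simp add: axial_def inner_vec_def sum_3 power2_eq_square field_simps)
  also have "\<dots> = ((E$1$1)\<^sup>2 + (E$2$1)\<^sup>2 + (E$3$1)\<^sup>2 + ((E$1$2)\<^sup>2 + (E$2$2)\<^sup>2 + (E$3$2)\<^sup>2)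
      + ((E$1$3)\<^sup>2 + (E$2$3)\<^sup>2 + (E$3$3)\<^sup>2))
    + 2 * (E$2$2 * E$3$3 - E$3$2 * E$2$3 + (E$3$3 * E$1$1 - E$1$3 * E$3$1)
      + (E$1$1 * E$2$2 - E$2$1 * E$1$2)) - (trace E)\<^sup>2"
    by (simp add: trace_def sum_3 power2_eq_square algebra_simps)
  also have "\<dots> = 3 + 2 * trace E - (trace E)\<^sup>2"
    by (simp only: n trace_def sum_3 flip: 1 2 3)
  also have "\<dots> = 4 * (rot_dist E * (2 - rot_dist E))"
    by (simp add: rot_dist_def field_simps power2_eq_square)
  finally show ?thesis
    by simp
qed

text \<open>A product \<open>d * (2 - d)\<close> equal to a squared norm is nonnegative, which
  confines \<open>d\<close> to the interval from 0 to 2.\<close>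

lemma rot_dist_SO3:
  assumes "E \<in> SO3"
  shows "0 \<le> rot_dist E" "rot_dist E \<le> 2"
proof -
  have "0 \<le> rot_dist E * (2 - rot_dist E)"
    unfolding norm_axial_SO3[OF assms, symmetric] by simp
  then show "0 \<le> rot_dist E" "rot_dist E \<le> 2"
    by (auto simp: zero_le_mult_iff)
qed

text \<open>The constant is (3 + 1) / 2, from the trace bound 3 and the isometry
  \<open>transpose E\<close>.\<close>

lemma norm_axial_mult_hat_le:
  assumes "E \<in> SO3"
  shows "norm (axial (E ** hat w)) \<le> 2 * norm w"
proof -
  have "\<bar>trace E\<bar> \<le> 3"
    using rot_dist_SO3[OF assms] by (simp add: rot_dist_def abs_le_iff)
  then have "norm (trace E *\<^sub>R w) \<le> 3 * norm w"
    by (simp add: mult_right_mono)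
  moreover have "norm (transpose E *v w) = norm w"
    by (rule norm_SO3_mult[OF SO3_transpose[OF assms]])
  ultimately have "norm (trace E *\<^sub>R w - transpose E *v w) \<le> 4 * norm w"
    using norm_triangle_ineq4[of "trace E *\<^sub>R w" "transpose E *v w"] by linarith
  then show ?thesis
    by (simp add: axial_mult_hat)
qed

section \<open>The error dynamics\<close>

lemma nonincreasing_on_half_line:
  fixes f :: "real \<Rightarrow> real"
  assumes der: "\<And>t. 0 \<le> t \<Longrightarrow> (f has_real_derivative f' t) (at t within {0..})"
    and nonpos: "\<And>t. 0 \<le> t \<Longrightarrow> f' t \<le> 0"
    and "0 \<le> t"
  shows "f t \<le> f 0"
proof -
  have "(f has_derivative (*) (f' s)) (at s within {0..t})" if "0 \<le> s" "s \<le> t" for s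
    using der[OF that(1)] unfolding has_field_derivative_def
    by (rule has_derivative_subset) auto
  from mvt_very_simple[OF \<open>0 \<le> t\<close> this]
  obtain s where "s \<in> {0..t}" "f t - f 0 = f' s * (t - 0)"
    by blast
  moreover from this have "f' s * t \<le> 0"
    using nonpos[of s] \<open>0 \<le> t\<close> by (simp add: mult_nonpos_nonneg)
  ultimately show ?thesis
    by simp
qed

text \<open>Differential Gronwall inequality: multiplying by the integrating factor
  \<open>exp (\<gamma> * t)\<close> yields a nonincreasing function.\<close>

lemma exponential_decay_on_half_line:
  fixes f :: "real \<Rightarrow> real"
  assumes der: "\<And>t. 0 \<le> t \<Longrightarrow> (f has_real_derivative f' t) (at t within {0..})"
    and le: "\<And>t. 0 \<le> t \<Longrightarrow> f' t \<le> - \<gamma> * f t"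
    and "0 \<le> t"
  shows "f t \<le> f 0 * exp (- \<gamma> * t)"
proof -
  have "((\<lambda>t. f t * exp (\<gamma> * t)) has_real_derivative (f' t + \<gamma> * f t) * exp (\<gamma> * t))
      (at t within {0..})" if "0 \<le> t" for t
    by (rule derivative_eq_intros der that refl)+ (simp add: algebra_simps)
  moreover have "(f' t + \<gamma> * f t) * exp (\<gamma> * t) \<le> 0" if "0 \<le> t" for t
    using le[OF that] by (simp add: mult_nonpos_nonneg)
  ultimately have "f t * exp (\<gamma> * t) \<le> f 0 * exp (\<gamma> * 0)"
    using \<open>0 \<le> t\<close> by (rule nonincreasing_on_half_line)
  then show ?thesis
    by (simp add: exp_minus field_simps)
qed

text \<open>The second equation is kept multiplied by \<open>J\<close>, so no inverse matrix enters.
  The command no longer appears: the system is autonomous.\<close>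

definition error_dynamics ::
  "real^3^3 \<Rightarrow> real \<Rightarrow> real \<Rightarrow> (real \<Rightarrow> real^3^3) \<Rightarrow> (real \<Rightarrow> real^3) \<Rightarrow> bool" where
  "error_dynamics J k\<^sub>R k\<^sub>\<Omega> E e \<longleftrightarrow> (\<forall>t\<ge>0. E t \<in> SO3 \<and>
     (E has_vector_derivative E t ** hat (e t)) (at t within {0..}) \<and>
     (\<exists>e'. (e has_vector_derivative e') (at t within {0..}) \<and>
        J *v e' = - k\<^sub>R *\<^sub>R axial (E t) - k\<^sub>\<Omega> *\<^sub>R e t))"

definition energy :: "real^3^3 \<Rightarrow> real \<Rightarrow> real^3^3 \<Rightarrow> real^3 \<Rightarrow> real" where
  "energy J k\<^sub>R E w = w \<bullet> (J *v w) / 2 + k\<^sub>R * rot_dist E"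

text \<open>The power of the proportional term in the kinetic part cancels the derivative of
  \<open>k\<^sub>R * rot_dist\<close>; only the damping remains.\<close>

lemma energy_has_derivative:
  assumes "error_dynamics J k\<^sub>R k\<^sub>\<Omega> E e" "transpose J = J" "0 \<le> t"
  shows "((\<lambda>t. energy J k\<^sub>R (E t) (e t)) has_real_derivative - k\<^sub>\<Omega> * (norm (e t))\<^sup>2)
    (at t within {0..})"
proof -
  obtain e' where E': "(E has_vector_derivative E t ** hat (e t)) (at t within {0..})"
    and e': "(e has_vector_derivative e') (at t within {0..})"
      "J *v e' = - k\<^sub>R *\<^sub>R axial (E t) - k\<^sub>\<Omega> *\<^sub>R e t"
    using assms(1,3) unfolding error_dynamics_def by blast
  have "((\<lambda>t. e t \<bullet> (J *v e t)) has_vector_derivative e t \<bullet> (J *v e') + e' \<bullet> (J *v e t))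
      (at t within {0..})"
    by (intro bounded_bilinear.has_vector_derivative[OF bounded_bilinear_inner]
      bounded_linear.has_vector_derivative[OF matrix_vector_mul_bounded_linear] e')
  moreover have "e' \<bullet> (J *v e t) = e t \<bullet> (J *v e')"
    by (rule inner_symmetric_matrix[OF assms(2)])
  ultimately have 1: "((\<lambda>t. e t \<bullet> (J *v e t)) has_real_derivative 2 * (e t \<bullet> (J *v e')))
      (at t within {0..})"
    by (simp add: has_real_derivative_iff_has_vector_derivative)
  have 2: "((\<lambda>t. trace (E t)) has_real_derivative - 2 * (axial (E t) \<bullet> e t)) (at t within {0..})"
    using bounded_linear.has_vector_derivative[OF bounded_linear_trace E']
    by (simp add: has_real_derivative_iff_has_vector_derivative trace_mult_hat)
  have "((\<lambda>t. energy J k\<^sub>R (E t) (e t)) has_real_derivative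
      2 * (e t \<bullet> (J *v e')) / 2 + k\<^sub>R * ((0 - - 2 * (axial (E t) \<bullet> e t)) / 2)) (at t within {0..})"
    unfolding energy_def rot_dist_def
    by (intro DERIV_add DERIV_cdivide DERIV_cmult DERIV_diff DERIV_const 1 2)
  then show ?thesis
    by (rule DERIV_cong) (simp add: e'(2) inner_diff_right
      inner_commute[of "e t" "axial (E t)"] power2_norm_eq_inner field_simps)
qed

text \<open>This supplies the negative multiple of \<open>(norm (axial E))\<^sup>2\<close> that the
  derivative of the energy lacks.\<close>

lemma cross_term_has_derivative:
  assumes "error_dynamics J k\<^sub>R k\<^sub>\<Omega> E e" "0 \<le> t"
  shows "((\<lambda>t. axial (E t) \<bullet> (J *v e t)) has_real_derivative
      axial (E t ** hat (e t)) \<bullet> (J *v e t) - k\<^sub>R * (norm (axial (E t)))\<^sup>2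
        - k\<^sub>\<Omega> * (axial (E t) \<bullet> e t))
    (at t within {0..})"
proof -
  obtain e' where E': "(E has_vector_derivative E t ** hat (e t)) (at t within {0..})"
    and e': "(e has_vector_derivative e') (at t within {0..})"
      "J *v e' = - k\<^sub>R *\<^sub>R axial (E t) - k\<^sub>\<Omega> *\<^sub>R e t"
    using assms(1,2) unfolding error_dynamics_def by blast
  have "((\<lambda>t. axial (E t) \<bullet> (J *v e t)) has_vector_derivative
      axial (E t) \<bullet> (J *v e') + axial (E t ** hat (e t)) \<bullet> (J *v e t)) (at t within {0..})"
    by (intro bounded_bilinear.has_vector_derivative[OF bounded_bilinear_inner]
      bounded_linear.has_vector_derivative[OF matrix_vector_mul_bounded_linear]
      bounded_linear.has_vector_derivative[OF bounded_linear_axial] E' e')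
  then show ?thesis
    by (simp add: has_real_derivative_iff_has_vector_derivative e'(2) inner_diff_right
      power2_norm_eq_inner algebra_simps)
qed

lemma energy_le_initial:
  assumes "error_dynamics J k\<^sub>R k\<^sub>\<Omega> E e" "transpose J = J" "0 \<le> k\<^sub>\<Omega>" "0 \<le> t"
  shows "energy J k\<^sub>R (E t) (e t) \<le> energy J k\<^sub>R (E 0) (e 0)"
  by (rule nonincreasing_on_half_line[OF energy_has_derivative[OF assms(1,2)]])
    (use assms in auto)

text \<open>The kinetic part is nonnegative, so an energy bound keeps the attitude error in a
  sublevel set.\<close>

lemma rot_dist_le_of_energy:
  assumes "sym_pos_def J" "0 < k\<^sub>R" "energy J k\<^sub>R E w \<le> k\<^sub>R * \<psi>"
  shows "rot_dist E \<le> \<psi>"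
proof -
  obtain \<mu> where "\<mu> > 0" and \<mu>: "\<And>x. \<mu> * (norm x)\<^sup>2 \<le> x \<bullet> (J *v x)"
    using sym_pos_def_lower_bound[OF assms(1)] by blast
  then have "0 \<le> w \<bullet> (J *v w)"
    by (meson mult_nonneg_nonneg less_imp_le order_trans zero_le_power2)
  then have "k\<^sub>R * rot_dist E \<le> k\<^sub>R * \<psi>"
    using assms(3) by (simp add: energy_def)
  then show ?thesis
    using assms(2) by simp
qed

section \<open>Exponential decay from a strict Lyapunov function\<close>

lemma two_mult_le_weighted_squares:
  fixes x y :: real
  assumes "0 < \<epsilon>"
  shows "2 * (x * y) \<le> \<epsilon> * x\<^sup>2 + y\<^sup>2 / \<epsilon>"
proof -
  have "0 \<le> (\<epsilon> * x - y)\<^sup>2 / \<epsilon>"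
    using assms by simp
  also have "\<dots> = \<epsilon> * x\<^sup>2 + y\<^sup>2 / \<epsilon> - 2 * (x * y)"
    using assms by (simp add: field_simps power2_eq_square)
  finally show ?thesis
    by simp
qed

text \<open>With \<open>r = e\<^sub>R\<close> the Lyapunov function is \<open>V = energy + c r \<cdot> J e\<close>, where \<open>c\<close> is small enough for
  the cross term to be dominated in \<open>V\<close>, and for its derivative to contribute the missing
  \<open>- c k\<^sub>R |r|\<^sup>2\<close> without destroying the damping \<open>- k\<^sub>\<Omega> |e|\<^sup>2\<close>.\<close>

lemma error_dynamics_exponential_decay:
  assumes J: "sym_pos_def J" and k\<^sub>R: "0 < k\<^sub>R" and k\<^sub>\<Omega>: "0 < k\<^sub>\<Omega>" and \<psi>: "\<psi> < 2"
  obtains \<alpha> \<beta> where "0 < \<alpha>" "0 < \<beta>"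
    "\<And>E e t. error_dynamics J k\<^sub>R k\<^sub>\<Omega> E e \<Longrightarrow> energy J k\<^sub>R (E 0) (e 0) \<le> k\<^sub>R * \<psi> \<Longrightarrow> 0 \<le> t \<Longrightarrow>
      norm (axial (E t), e t) \<le> \<alpha> * norm (axial (E 0), e 0) * exp (- \<beta> * t)"
proof -
  have sym: "transpose J = J"
    using J by (simp add: sym_pos_def_def)
  obtain \<mu> where \<mu>: "\<mu> > 0" "\<And>x. \<mu> * (norm x)\<^sup>2 \<le> x \<bullet> (J *v x)"
    using sym_pos_def_lower_bound[OF J] by blast
  obtain L where L: "L > 0" "\<And>x. norm (J *v x) \<le> L * norm x"
    using linear_bounded_pos[OF matrix_vector_mul_linear[of J]] by (metis mult.commute)
  \<comment> \<open>\<open>P\<close> bounds the coefficient of the squared velocity error in the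
    derivative of the cross term: \<open>2 * L\<close> from the velocity of \<open>axial\<close>,
    the rest from the weighted inequality on the mixed term, which uses up half of the
    \<open>k\<^sub>R\<close> term.\<close>
  define P where "P = 2 * L + k\<^sub>\<Omega>\<^sup>2 / (2 * k\<^sub>R)"
  have P: "0 < P"
    using L(1) k\<^sub>R k\<^sub>\<Omega> by (simp add: P_def add_pos_pos)
  \<comment> \<open>The first bound leaves half of the damping intact (\<open>cP\<close>); the
    second lets the cross term use at most half of the lower bound on the energy
    (\<open>cL\<close>).\<close>
  define c where "c = min (k\<^sub>\<Omega> / (2 * P)) (min \<mu> k\<^sub>R / (2 * L))"
  have c: "0 < c"
    using P L(1) \<mu>(1) k\<^sub>R k\<^sub>\<Omega> by (simp add: c_def)
  have cP: "c * P \<le> k\<^sub>\<Omega> / 2"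
  proof -
    have "c \<le> k\<^sub>\<Omega> / (2 * P)"
      by (simp add: c_def)
    then show ?thesis
      using P by (simp add: field_simps)
  qed
  have cL: "c * L \<le> min \<mu> k\<^sub>R / 2"
  proof -
    have "c \<le> min \<mu> k\<^sub>R / (2 * L)"
      by (simp add: c_def)
    then show ?thesis
      using L(1) by (simp add: field_simps)
  qed
  \<comment> \<open>\<open>A\<close> and \<open>B\<close> compare the Lyapunov function with the
    squared error norm from below and above; \<open>a\<close> is its dissipation rate relative to
    that norm.\<close>
  define A where "A = min \<mu> k\<^sub>R / 4"
  define B where "B = L + k\<^sub>R / (2 - \<psi>) + c * L"
  define a where "a = min (k\<^sub>\<Omega> / 2) (c * k\<^sub>R / 2)"
  have pos: "0 < A" "0 < B" "0 < a"
    using \<mu>(1) k\<^sub>R k\<^sub>\<Omega> L(1) c \<psi> by (auto simp: A_def B_def a_def add_pos_pos)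
  let ?V = "\<lambda>E w. energy J k\<^sub>R E w + c * (axial E \<bullet> (J *v w))"
  have cross: "\<bar>c * (axial E \<bullet> (J *v w))\<bar> \<le> c * L / 2 * ((norm (axial E))\<^sup>2 + (norm w)\<^sup>2)" for E w
  proof -
    have "\<bar>axial E \<bullet> (J *v w)\<bar> \<le> norm (axial E) * (L * norm w)"
      by (rule order_trans[OF Cauchy_Schwarz_ineq2]) (simp add: L(2) mult_left_mono)
    also have "\<dots> \<le> L / 2 * ((norm (axial E))\<^sup>2 + (norm w)\<^sup>2)"
      using mult_left_mono[OF two_mult_le_weighted_squares[of 1 "norm (axial E)" "norm w"], of L] L(1)
      by (simp add: algebra_simps)
    finally show ?thesis
      using mult_left_mono[of "\<bar>axial E \<bullet> (J *v w)\<bar>" _ c] c by (simp add: abs_mult)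
  qed
  have r_le: "(norm (axial E))\<^sup>2 \<le> 2 * rot_dist E" if "E \<in> SO3" for E
    using rot_dist_SO3[OF that] by (simp add: norm_axial_SO3[OF that] algebra_simps)
  \<comment> \<open>On the sublevel set the factor \<open>2 - rot_dist E\<close> is at least
    \<open>2 - \<psi>\<close>, so the potential is controlled by the squared attitude error.\<close>
  have r_ge: "(2 - \<psi>) * rot_dist E \<le> (norm (axial E))\<^sup>2" if "E \<in> SO3" "rot_dist E \<le> \<psi>" for E
    using rot_dist_SO3[OF that(1)] that(2)
    by (simp add: norm_axial_SO3[OF that(1)] mult_mono mult.commute mult_left_mono)
  have lower: "A * ((norm (axial E))\<^sup>2 + (norm w)\<^sup>2) \<le> ?V E w" if "E \<in> SO3" for E w
  proof -
    have "A * ((norm (axial E))\<^sup>2 + (norm w)\<^sup>2) + c * L / 2 * ((norm (axial E))\<^sup>2 + (norm w)\<^sup>2)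
      \<le> min \<mu> k\<^sub>R / 2 * ((norm (axial E))\<^sup>2 + (norm w)\<^sup>2)"
      unfolding distrib_right[symmetric] A_def
      by (rule mult_right_mono) (use cL in auto)
    also have "\<dots> \<le> k\<^sub>R / 2 * (norm (axial E))\<^sup>2 + \<mu> / 2 * (norm w)\<^sup>2"
      unfolding distrib_left by (intro add_mono mult_right_mono) auto
    also have "\<dots> \<le> energy J k\<^sub>R E w"
    proof -
      have "k\<^sub>R / 2 * (norm (axial E))\<^sup>2 \<le> k\<^sub>R / 2 * (2 * rot_dist E)"
        using r_le[OF that] k\<^sub>R by (intro mult_left_mono) auto
      then show ?thesis
        using \<mu>(2)[of w] by (simp add: energy_def)
    qed
    finally show ?thesis
      using cross[of E w] by linarith
  qed
  have upper: "?V E w \<le> B * ((norm (axial E))\<^sup>2 + (norm w)\<^sup>2)" if "E \<in> SO3" "rot_dist E \<le> \<psi>" for E w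
  proof -
    have "w \<bullet> (J *v w) \<le> norm w * (L * norm w)"
      by (rule order_trans[OF norm_cauchy_schwarz]) (simp add: L(2) mult_left_mono)
    also have "\<dots> = L * (norm w)\<^sup>2"
      by (simp add: power2_eq_square)
    finally have "w \<bullet> (J *v w) / 2 \<le> L * (norm w)\<^sup>2"
      using mult_nonneg_nonneg[of L "(norm w)\<^sup>2"] L(1) zero_le_power2[of "norm w"] by linarith
    moreover have "k\<^sub>R * rot_dist E \<le> k\<^sub>R / (2 - \<psi>) * (norm (axial E))\<^sup>2"
      using mult_left_mono[OF r_ge[OF that], of k\<^sub>R] k\<^sub>R \<psi> by (simp add: field_simps)
    moreover have "0 \<le> L * (norm (axial E))\<^sup>2" "0 \<le> k\<^sub>R / (2 - \<psi>) * (norm w)\<^sup>2"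
      "0 \<le> c * L / 2 * ((norm (axial E))\<^sup>2 + (norm w)\<^sup>2)"
      using L(1) k\<^sub>R \<psi> c by auto
    ultimately show ?thesis
      using cross[of E w] by (simp add: energy_def B_def distrib_left distrib_right)
  qed
  \<comment> \<open>The Lyapunov function decays at rate \<open>a / B\<close>; passing to the norm
    takes a square root, hence the root here and the factor 2 in \<open>\<beta>\<close>.\<close>
  define \<alpha> where "\<alpha> = sqrt (B / A)"
  define \<beta> where "\<beta> = a / (2 * B)"
  show thesis
  proof
    show "0 < \<alpha>" "0 < \<beta>"
      using pos by (simp_all add: \<alpha>_def \<beta>_def)
  next
    fix E e and t :: real
    assume dyn: "error_dynamics J k\<^sub>R k\<^sub>\<Omega> E e"
      and init: "energy J k\<^sub>R (E 0) (e 0) \<le> k\<^sub>R * \<psi>" and "0 \<le> t"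
    have SO3: "E s \<in> SO3" if "0 \<le> s" for s
      using dyn that by (simp add: error_dynamics_def)
    \<comment> \<open>The sublevel set is invariant, so \<open>upper\<close> applies at every
      time.\<close>
    have sub: "rot_dist (E s) \<le> \<psi>" if "0 \<le> s" for s
      using energy_le_initial[OF dyn sym _ that] k\<^sub>\<Omega> init
      by (intro rot_dist_le_of_energy[OF J k\<^sub>R, where w = "e s"]) linarith
    let ?n = "\<lambda>s. (norm (axial (E s)))\<^sup>2 + (norm (e s))\<^sup>2"
    let ?V' = "\<lambda>s. - k\<^sub>\<Omega> * (norm (e s))\<^sup>2 + c * (axial (E s ** hat (e s)) \<bullet> (J *v e s)
      - k\<^sub>R * (norm (axial (E s)))\<^sup>2 - k\<^sub>\<Omega> * (axial (E s) \<bullet> e s))"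
    have der: "((\<lambda>s. ?V (E s) (e s)) has_real_derivative ?V' s) (at s within {0..})"
      if "0 \<le> s" for s
      by (intro DERIV_add DERIV_cmult energy_has_derivative[OF dyn sym that]
        cross_term_has_derivative[OF dyn that])
    have V': "?V' s \<le> - (a / B) * ?V (E s) (e s)" if "0 \<le> s" for s
    proof -
      let ?r = "norm (axial (E s))" and ?e = "norm (e s)"
      have "axial (E s ** hat (e s)) \<bullet> (J *v e s) \<le> (2 * ?e) * (L * ?e)"
        by (rule order_trans[OF norm_cauchy_schwarz])
          (intro mult_mono norm_axial_mult_hat_le SO3 that L(2), auto)
      also have "\<dots> = 2 * L * ?e\<^sup>2"
        by (simp add: power2_eq_square)
      finally have "axial (E s ** hat (e s)) \<bullet> (J *v e s) \<le> 2 * L * ?e\<^sup>2" .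
      moreover have "- (k\<^sub>\<Omega> * (axial (E s) \<bullet> e s)) \<le> k\<^sub>R / 2 * ?r\<^sup>2 + k\<^sub>\<Omega>\<^sup>2 / (2 * k\<^sub>R) * ?e\<^sup>2"
      proof -
        have "- (axial (E s) \<bullet> e s) \<le> ?r * ?e"
          using Cauchy_Schwarz_ineq2[of "axial (E s)" "e s"] by linarith
        then have "k\<^sub>\<Omega> * - (axial (E s) \<bullet> e s) \<le> k\<^sub>\<Omega> * (?r * ?e)"
          using k\<^sub>\<Omega> by (intro mult_left_mono) auto
        moreover have "2 * (?r * (k\<^sub>\<Omega> * ?e)) \<le> k\<^sub>R * ?r\<^sup>2 + (k\<^sub>\<Omega> * ?e)\<^sup>2 / k\<^sub>R"
          by (rule two_mult_le_weighted_squares[OF k\<^sub>R])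
        ultimately show ?thesis
          by (simp add: power_mult_distrib field_simps)
      qed
      ultimately have "axial (E s ** hat (e s)) \<bullet> (J *v e s) - k\<^sub>R * ?r\<^sup>2
          - k\<^sub>\<Omega> * (axial (E s) \<bullet> e s) \<le> P * ?e\<^sup>2 - k\<^sub>R / 2 * ?r\<^sup>2"
        unfolding P_def distrib_right by linarith
      then have "?V' s \<le> - k\<^sub>\<Omega> * ?e\<^sup>2 + c * (P * ?e\<^sup>2 - k\<^sub>R / 2 * ?r\<^sup>2)"
        using c by (intro add_left_mono mult_left_mono) auto
      also have "\<dots> = - (k\<^sub>\<Omega> - c * P) * ?e\<^sup>2 - c * k\<^sub>R / 2 * ?r\<^sup>2"
        by (simp add: algebra_simps)
      also have "\<dots> \<le> - a * ?e\<^sup>2 - a * ?r\<^sup>2"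
        by (intro diff_mono mult_right_mono) (use cP in \<open>auto simp: a_def\<close>)
      also have "\<dots> = - (a / B) * (B * ?n s)"
        using pos(2) by (simp add: algebra_simps)
      also have "\<dots> \<le> - (a / B) * ?V (E s) (e s)"
        using upper[OF SO3 sub, OF that that, of "e s"] pos
        by (intro mult_left_mono_neg) auto
      finally show ?thesis .
    qed
    have "A * ?n t \<le> ?V (E t) (e t)"
      by (rule lower[OF SO3[OF \<open>0 \<le> t\<close>]])
    also have "\<dots> \<le> ?V (E 0) (e 0) * exp (- (a / B) * t)"
      by (rule exponential_decay_on_half_line[OF der V' \<open>0 \<le> t\<close>])
    also have "\<dots> \<le> B * ?n 0 * exp (- (a / B) * t)"
      by (intro mult_right_mono upper SO3 sub) auto
    finally have "?n t \<le> B / A * ?n 0 * exp (- (a / B) * t)"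
      using pos(1) by (simp add: field_simps)
    also have "exp (- (a / B) * t) = (exp (- \<beta> * t))\<^sup>2"
      using pos(2) by (simp add: \<beta>_def exp_of_nat_mult[symmetric] power2_eq_square exp_add[symmetric])
    finally have "sqrt (?n t) \<le> sqrt (B / A * ?n 0 * (exp (- \<beta> * t))\<^sup>2)"
      by (rule real_sqrt_le_mono)
    then show "norm (axial (E t), e t) \<le> \<alpha> * norm (axial (E 0), e 0) * exp (- \<beta> * t)"
      by (simp only: norm_Pair \<alpha>_def real_sqrt_mult real_sqrt_abs abs_exp_cancel)
  qed
qed

section \<open>Reduction of the closed loop\<close>

text \<open>Every point of the half line, 0 included, is a limit of later times, so the one-sided
  derivative is unique.\<close>

lemma time_deriv_eqI:
  assumes "(f has_vector_derivative f') (at t within {0..})" "0 \<le> t"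
  shows "time_deriv f t = f'"
proof (rule vector_derivative_within[OF _ assms(1)])
  have "at_right t \<le> at t within {0..}"
    using assms(2) by (intro at_le) auto
  then show "at t within {0..} \<noteq> bot"
    using trivial_limit_at_right_real[of t] by (metis bot.extremum_uniqueI)
qed

text \<open>On the half line \<open>\<Omega>d\<close> is \<open>axial\<close> of
  \<open>transpose Rd\<close> times the derivative of \<open>Rd\<close>, so two derivatives of
  \<open>Rd\<close> make it differentiable and \<open>time_deriv \<Omega>d\<close> a genuine
  derivative.\<close>

lemma attitude_command_derivatives:
  assumes "attitude_command Rd \<Omega>d" "0 \<le> t"
  shows "(Rd has_vector_derivative Rd t ** hat (\<Omega>d t)) (at t within {0..})"
    and "(\<Omega>d has_vector_derivative time_deriv \<Omega>d t) (at t within {0..})"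
proof -
  obtain D where D0: "\<And>t. 0 \<le> t \<Longrightarrow> D 0 t = Rd t"
    and D: "\<And>n t. 0 \<le> t \<Longrightarrow> (D n has_vector_derivative D (Suc n) t) (at t within {0..})"
    using assms(1) unfolding attitude_command_def smooth_in_time_def by blast
  have Rd: "(Rd has_vector_derivative D 1 t) (at t within {0..})" if "0 \<le> t" for t
    by (rule has_vector_derivative_transform[OF _ _ D[OF that, of 0, folded One_nat_def]]) (use that D0 in auto)
  have hat: "hat (\<Omega>d t) = transpose (Rd t) ** D 1 t" and SO3: "Rd t \<in> SO3" if "0 \<le> t" for t
    using assms(1) that time_deriv_eqI[OF Rd[OF that] that] by (auto simp: attitude_command_def)
  have "Rd t ** hat (\<Omega>d t) = D 1 t"
    by (simp add: hat assms(2) matrix_mul_assoc SO3_mult_transpose SO3)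
  then show "(Rd has_vector_derivative Rd t ** hat (\<Omega>d t)) (at t within {0..})"
    using Rd[OF assms(2)] by simp
  have axial_hat: "axial (hat x) = x" for x
    by (simp add: axial_def hat_component vec_eq_iff forall_3)
  have "((\<lambda>t. axial (transpose (Rd t) ** D 1 t)) has_vector_derivative
      axial (transpose (Rd t) ** D 2 t + transpose (D 1 t) ** D 1 t)) (at t within {0..})"
    using D[OF assms(2), of 1]
    by (intro bounded_linear.has_vector_derivative[OF bounded_linear_axial]
      bounded_bilinear.has_vector_derivative[OF bounded_bilinear_matrix_matrix_mult]
      bounded_linear.has_vector_derivative[OF bounded_linear_transpose] Rd assms(2))
      (simp add: numeral_2_eq_2)
  then have "(\<Omega>d has_vector_derivative
      axial (transpose (Rd t) ** D 2 t + transpose (D 1 t) ** D 1 t)) (at t within {0..})"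
    by (rule has_vector_derivative_transform[rotated 2])
      (use assms(2) in \<open>auto simp: axial_hat simp del: One_nat_def simp flip: hat\<close>)
  then show "(\<Omega>d has_vector_derivative time_deriv \<Omega>d t) (at t within {0..})"
    unfolding vector_derivative_works[symmetric] by (rule differentiableI_vector)
qed

text \<open>Passing to \<open>transpose Rd ** R\<close> removes the command from the kinematics, and
  the feedforward and gyroscopic terms of the moment cancel the rest in the dynamics.\<close>

lemma closed_loop_error_dynamics:
  assumes cmd: "attitude_command Rd \<Omega>d" and loop: "closed_loop J k\<^sub>R k\<^sub>\<Omega> Rd \<Omega>d R \<Omega>"
  shows "error_dynamics J k\<^sub>R k\<^sub>\<Omega> (\<lambda>t. transpose (Rd t) ** R t)
    (\<lambda>t. e_\<Omega> (R t) (\<Omega> t) (Rd t) (\<Omega>d t))"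
  unfolding error_dynamics_def
proof (intro allI impI conjI)
  fix t :: real
  assume t: "0 \<le> t"
  let ?E = "\<lambda>t. transpose (Rd t) ** R t" and ?e = "\<lambda>t. e_\<Omega> (R t) (\<Omega> t) (Rd t) (\<Omega>d t)"
  have Rd_SO3: "Rd t \<in> SO3" and R_SO3: "R t \<in> SO3"
    using assms t by (auto simp: attitude_command_def closed_loop_def attitude_dynamics_def)
  then show E_SO3: "?E t \<in> SO3"
    by (intro SO3_mult SO3_transpose)
  have Rd': "(Rd has_vector_derivative Rd t ** hat (\<Omega>d t)) (at t within {0..})"
    and \<Omega>d': "(\<Omega>d has_vector_derivative time_deriv \<Omega>d t) (at t within {0..})"
    by (rule attitude_command_derivatives[OF cmd t])+
  have R': "(R has_vector_derivative R t ** hat (\<Omega> t)) (at t within {0..})"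
    and \<Omega>': "(\<Omega> has_vector_derivative time_deriv \<Omega> t) (at t within {0..})"
    and M: "J *v time_deriv \<Omega> t + \<Omega> t \<times> (J *v \<Omega> t) =
      control_moment J k\<^sub>R k\<^sub>\<Omega> (R t) (\<Omega> t) (Rd t) (\<Omega>d t) (time_deriv \<Omega>d t)"
    using loop t unfolding closed_loop_def attitude_dynamics_def vector_derivative_works
    by auto
  have ET: "transpose (?E s) = transpose (R s) ** Rd s" for s
    by (simp add: matrix_transpose_mul)
  have e_eq: "?e s = \<Omega> s - transpose (?E s) *v \<Omega>d s" for s
    by (simp only: e_\<Omega>_def ET)
  have hat_diff: "hat (x - y) = hat x - hat y" for x y
    by (simp add: hat_component vec_eq_iff forall_3)
  \<comment> \<open>Conjugation moves the command velocity from the left of the error attitude to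
    its right, where it combines with \<open>\<Omega>\<close>.\<close>
  have hat_E: "?E t ** hat (transpose (?E t) *v x) = hat x ** ?E t" for x
    by (simp only: SO3_conj_hat[OF E_SO3, symmetric] matrix_mul_assoc SO3_mult_transpose[OF E_SO3]
      matrix_mul_lid)
  have "(?E has_vector_derivative
      transpose (Rd t) ** (R t ** hat (\<Omega> t)) + transpose (Rd t ** hat (\<Omega>d t)) ** R t)
      (at t within {0..})"
    by (intro bounded_bilinear.has_vector_derivative[OF bounded_bilinear_matrix_matrix_mult]
      bounded_linear.has_vector_derivative[OF bounded_linear_transpose] Rd' R')
  also have "transpose (Rd t) ** (R t ** hat (\<Omega> t)) + transpose (Rd t ** hat (\<Omega>d t)) ** R t =
      ?E t ** hat (\<Omega> t) + - hat (\<Omega>d t) ** ?E t"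
    by (simp only: matrix_transpose_mul matrix_mul_assoc transpose_hat)
  also have "\<dots> = ?E t ** hat (\<Omega> t) - hat (\<Omega>d t) ** ?E t"
    by (simp add: bounded_bilinear.minus_left[OF bounded_bilinear_matrix_matrix_mult])
  also have "\<dots> = ?E t ** hat (?e t)"
    by (simp only: e_eq hat_diff hat_E[symmetric]
      bounded_bilinear.diff_right[OF bounded_bilinear_matrix_matrix_mult])
  finally show E': "(?E has_vector_derivative ?E t ** hat (?e t)) (at t within {0..})" .
  define e' where "e' = time_deriv \<Omega> t -
    (transpose (?E t) *v time_deriv \<Omega>d t + transpose (?E t ** hat (?e t)) *v \<Omega>d t)"
  have "(?e has_vector_derivative e') (at t within {0..})"
    unfolding e'_def unfolding e_eq
    by (intro has_vector_derivative_diff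
      bounded_bilinear.has_vector_derivative[OF bounded_bilinear_matrix_vector_mult]
      bounded_linear.has_vector_derivative[OF bounded_linear_transpose] E'[unfolded e_eq] \<Omega>' \<Omega>d')
  moreover have "J *v e' = - k\<^sub>R *\<^sub>R axial (?E t) - k\<^sub>\<Omega> *\<^sub>R ?e t"
  proof -
    define y where "y = transpose (?E t) *v \<Omega>d t"
    have "transpose (?E t ** hat (?e t)) *v \<Omega>d t = - hat (?e t) *v y"
      by (simp only: matrix_transpose_mul transpose_hat matrix_vector_mul_assoc[symmetric] y_def)
    also have "\<dots> = - (?e t \<times> y)"
      by (simp add: bounded_bilinear.minus_left[OF bounded_bilinear_matrix_vector_mult] hat_mult_vec)
    \<comment> \<open>The velocity error is \<open>\<Omega> t - y\<close>, and
      \<open>y \<times> y\<close> vanishes.\<close>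
    also have "\<dots> = - (\<Omega> t \<times> y)"
      by (simp only: e_eq flip: y_def)
        (simp add: bounded_bilinear.diff_left[OF bilinear_cross[unfolded bilinear_conv_bounded_bilinear]])
    finally have 1: "e' = time_deriv \<Omega> t - (transpose (?E t) *v time_deriv \<Omega>d t - \<Omega> t \<times> y)"
      by (simp add: e'_def)
    have 2: "(hat (\<Omega> t) ** transpose (R t) ** Rd t) *v \<Omega>d t = \<Omega> t \<times> y"
      by (simp only: y_def ET matrix_mul_assoc[symmetric] flip: hat_mult_vec matrix_vector_mul_assoc)
    show ?thesis
      using M unfolding control_moment_def 2 e_R_eq_axial ET[symmetric]
      by (simp add: 1 matrix_vector_mult_diff_distrib matrix_vector_right_distrib algebra_simps)
  qed
  ultimately show "\<exists>e'. (?e has_vector_derivative e') (at t within {0..}) \<and>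
      J *v e' = - k\<^sub>R *\<^sub>R axial (?E t) - k\<^sub>\<Omega> *\<^sub>R ?e t"
    by blast
qed

section \<open>The region of attraction\<close>

text \<open>After clearing the denominator, the velocity condition bounds the energy with
  \<open>lambda_max J\<close> in place of the kinetic form.\<close>

lemma initial_region_energy_less:
  assumes J: "sym_pos_def J" and "0 < k\<^sub>R" and "(R0, \<Omega>0) \<in> initial_region J k\<^sub>R Rd0 \<Omega>d0"
  shows "energy J k\<^sub>R (transpose Rd0 ** R0) (e_\<Omega> R0 \<Omega>0 Rd0 \<Omega>d0) < k\<^sub>R * 2"
proof -
  define w where "w = e_\<Omega> R0 \<Omega>0 Rd0 \<Omega>d0"
  have upper: "x \<bullet> (J *v x) \<le> lambda_max J * (norm x)\<^sup>2" for x
    using J by (intro quadratic_form_le_lambda_max) (simp add: sym_pos_def_def)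
  have "0 < axis 1 1 \<bullet> (J *v (axis 1 1 :: real^3))"
    using J by (simp add: sym_pos_def_def axis_eq_0_iff)
  also have "\<dots> \<le> lambda_max J"
    using upper[of "axis 1 1"] by (simp add: norm_axis_1)
  finally have pos: "0 < lambda_max J" .
  have "(norm w)\<^sup>2 < 2 / lambda_max J * k\<^sub>R * (2 - rot_dist (transpose Rd0 ** R0))"
    using assms(3) by (simp add: initial_region_def w_def \<Psi>_eq_rot_dist)
  then have "lambda_max J * (norm w)\<^sup>2 < 2 * k\<^sub>R * (2 - rot_dist (transpose Rd0 ** R0))"
    using pos by (simp add: field_simps)
  with upper[of w] show ?thesis
    by (simp add: energy_def w_def algebra_simps)
qed

text \<open>The energy attains its maximum on \<open>K\<close>, which turns the strict pointwise
  bound into one gap below 2 for all initial states in \<open>K\<close>.\<close>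

lemma compact_initial_energy_bound:
  assumes J: "sym_pos_def J" and k\<^sub>R: "0 < k\<^sub>R"
    and K: "compact K" "K \<subseteq> initial_region J k\<^sub>R Rd0 \<Omega>d0"
  obtains \<psi> where "\<psi> < 2" "\<And>R0 \<Omega>0. (R0, \<Omega>0) \<in> K \<Longrightarrow>
    energy J k\<^sub>R (transpose Rd0 ** R0) (e_\<Omega> R0 \<Omega>0 Rd0 \<Omega>d0) \<le> k\<^sub>R * \<psi>"
proof (cases "K = {}")
  case True
  then show thesis
    using that[of 0] by simp
next
  case False
  let ?f = "\<lambda>p. energy J k\<^sub>R (transpose Rd0 ** fst p) (e_\<Omega> (fst p) (snd p) Rd0 \<Omega>d0)"
  note continuous_mult = bounded_bilinear.continuous_on[OF bounded_bilinear_matrix_matrix_mult]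
    bounded_bilinear.continuous_on[OF bounded_bilinear_matrix_vector_mult]
    bounded_linear.continuous_on[OF bounded_linear_transpose]
    bounded_linear.continuous_on[OF bounded_linear_trace]
  have "continuous_on K ?f"
    unfolding energy_def rot_dist_def e_\<Omega>_def
    by (intro continuous_intros continuous_mult) auto
  then obtain p where p: "p \<in> K" "\<And>q. q \<in> K \<Longrightarrow> ?f q \<le> ?f p"
    using continuous_attains_sup[OF K(1) False] by blast
  have "?f p < k\<^sub>R * 2"
    using p(1) K(2) by (intro initial_region_energy_less[OF J k\<^sub>R]) auto
  then have "?f p / k\<^sub>R < 2"
    using k\<^sub>R by (simp add: field_simps)
  moreover have "?f (R0, \<Omega>0) \<le> k\<^sub>R * (?f p / k\<^sub>R)" if "(R0, \<Omega>0) \<in> K" for R0 \<Omega>0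
    using p(2)[OF that] k\<^sub>R by simp
  ultimately show thesis
    using that[of "?f p / k\<^sub>R"] by simp
qed

text \<open>The bound on \<open>\<Psi>\<close> follows from that on \<open>z\<close>: on the
  sublevel set \<open>(2 - \<psi>) * \<Psi>\<close> is at most the squared norm of \<open>z\<close>,
  which doubles the rate.\<close>

lemma closed_loop_uniform_bounds:
  fixes Rd :: "real \<Rightarrow> real^3^3" and \<Omega>d :: "real \<Rightarrow> real^3"
  defines "z \<equiv> \<lambda>R \<Omega> t. (e_R (R t) (Rd t), e_\<Omega> (R t) (\<Omega> t) (Rd t) (\<Omega>d t))"
  assumes J: "sym_pos_def J" and k\<^sub>R: "0 < k\<^sub>R" and k\<^sub>\<Omega>: "0 < k\<^sub>\<Omega>"
    and cmd: "attitude_command Rd \<Omega>d"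
    and K: "compact K" "K \<subseteq> initial_region J k\<^sub>R (Rd 0) (\<Omega>d 0)"
  obtains \<alpha> \<beta> \<alpha>\<^sub>2 \<beta>\<^sub>2 where "0 < \<alpha>" "0 < \<beta>" "0 < \<alpha>\<^sub>2" "0 < \<beta>\<^sub>2"
    "\<And>R \<Omega> t. closed_loop J k\<^sub>R k\<^sub>\<Omega> Rd \<Omega>d R \<Omega> \<Longrightarrow> (R 0, \<Omega> 0) \<in> K \<Longrightarrow> 0 \<le> t \<Longrightarrow>
      norm (z R \<Omega> t) \<le> \<alpha> * norm (z R \<Omega> 0) * exp (- \<beta> * t)"
    "\<And>R \<Omega> t. closed_loop J k\<^sub>R k\<^sub>\<Omega> Rd \<Omega>d R \<Omega> \<Longrightarrow> (R 0, \<Omega> 0) \<in> K \<Longrightarrow> 0 \<le> t \<Longrightarrow>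
      \<Psi> (R t) (Rd t) \<le> min 2 (\<alpha>\<^sub>2 * exp (- \<beta>\<^sub>2 * t))"
proof -
  obtain \<psi> where \<psi>: "\<psi> < 2" and energy0: "\<And>R0 \<Omega>0. (R0, \<Omega>0) \<in> K \<Longrightarrow>
      energy J k\<^sub>R (transpose (Rd 0) ** R0) (e_\<Omega> R0 \<Omega>0 (Rd 0) (\<Omega>d 0)) \<le> k\<^sub>R * \<psi>"
    using compact_initial_energy_bound[OF J k\<^sub>R K] by blast
  obtain \<alpha> \<beta> where pos: "0 < \<alpha>" "0 < \<beta>" and decay:
    "\<And>E e t. error_dynamics J k\<^sub>R k\<^sub>\<Omega> E e \<Longrightarrow> energy J k\<^sub>R (E 0) (e 0) \<le> k\<^sub>R * \<psi> \<Longrightarrow> 0 \<le> t \<Longrightarrow>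
      norm (axial (E t), e t) \<le> \<alpha> * norm (axial (E 0), e 0) * exp (- \<beta> * t)"
    using error_dynamics_exponential_decay[OF J k\<^sub>R k\<^sub>\<Omega> \<psi>] by blast
  \<comment> \<open>A common bound for the initial errors makes the prefactor of the bound on
    \<open>\<Psi>\<close> independent of the trajectory.\<close>
  obtain C where C: "0 < C" "\<And>R0 \<Omega>0. (R0, \<Omega>0) \<in> K \<Longrightarrow>
      norm (axial (transpose (Rd 0) ** R0), e_\<Omega> R0 \<Omega>0 (Rd 0) (\<Omega>d 0)) \<le> C"
  proof -
    have "continuous_on K (\<lambda>p. (axial (transpose (Rd 0) ** fst p), e_\<Omega> (fst p) (snd p) (Rd 0) (\<Omega>d 0)))"
      unfolding e_\<Omega>_def
      by (intro continuous_intros bounded_linear.continuous_on[OF bounded_linear_axial]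
        bounded_bilinear.continuous_on[OF bounded_bilinear_matrix_matrix_mult]
        bounded_bilinear.continuous_on[OF bounded_bilinear_matrix_vector_mult]
        bounded_linear.continuous_on[OF bounded_linear_transpose])
    then have "bounded ((\<lambda>p. (axial (transpose (Rd 0) ** fst p), e_\<Omega> (fst p) (snd p) (Rd 0) (\<Omega>d 0))) ` K)"
      by (intro compact_imp_bounded compact_continuous_image K)
    then show thesis
      unfolding bounded_pos using that by force
  qed
  have bounds: "norm (z R \<Omega> t) \<le> \<alpha> * norm (z R \<Omega> 0) * exp (- \<beta> * t) \<and>
      \<Psi> (R t) (Rd t) \<le> min 2 ((\<alpha> * C)\<^sup>2 / (2 - \<psi>) * exp (- (2 * \<beta>) * t))"
    if loop: "closed_loop J k\<^sub>R k\<^sub>\<Omega> Rd \<Omega>d R \<Omega>" and init: "(R 0, \<Omega> 0) \<in> K" and t: "0 \<le> t" for R \<Omega> t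
  proof -
    let ?E = "\<lambda>t. transpose (Rd t) ** R t" and ?e = "\<lambda>t. e_\<Omega> (R t) (\<Omega> t) (Rd t) (\<Omega>d t)"
    have dyn: "error_dynamics J k\<^sub>R k\<^sub>\<Omega> ?E ?e"
      by (rule closed_loop_error_dynamics[OF cmd loop])
    have z: "norm (z R \<Omega> t) \<le> \<alpha> * norm (z R \<Omega> 0) * exp (- \<beta> * t)"
      unfolding z_def e_R_eq_axial by (rule decay[OF dyn energy0[OF init] t])
    have SO3: "?E t \<in> SO3"
      using dyn t by (simp add: error_dynamics_def)
    have "energy J k\<^sub>R (?E t) (?e t) \<le> k\<^sub>R * \<psi>"
      using energy_le_initial[OF dyn _ _ t] energy0[OF init] J k\<^sub>\<Omega>
      by (simp add: sym_pos_def_def)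
    then have sub: "rot_dist (?E t) \<le> \<psi>"
      by (rule rot_dist_le_of_energy[OF J k\<^sub>R])
    have "(2 - \<psi>) * rot_dist (?E t) \<le> (norm (axial (?E t)))\<^sup>2"
      unfolding norm_axial_SO3[OF SO3] mult.commute[of "rot_dist _"]
      using sub rot_dist_SO3[OF SO3] by (intro mult_right_mono) auto
    also have "\<dots> \<le> (norm (z R \<Omega> t))\<^sup>2"
      by (simp add: norm_Pair z_def e_R_eq_axial)
    also have "\<dots> \<le> (\<alpha> * C * exp (- \<beta> * t))\<^sup>2"
    proof (rule power_mono[OF order_trans[OF z]])
      show "\<alpha> * norm (z R \<Omega> 0) * exp (- \<beta> * t) \<le> \<alpha> * C * exp (- \<beta> * t)"
        using C(2)[OF init] pos(1) by (simp add: z_def e_R_eq_axial)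
    qed simp
    also have "\<dots> = (\<alpha> * C)\<^sup>2 * exp (- (2 * \<beta>) * t)"
      by (simp add: power_mult_distrib power2_eq_square[of "exp _"] exp_add[symmetric])
    finally have "rot_dist (?E t) \<le> (\<alpha> * C)\<^sup>2 / (2 - \<psi>) * exp (- (2 * \<beta>) * t)"
      using \<psi> by (simp add: field_simps)
    then show ?thesis
      using z rot_dist_SO3[OF SO3] by (simp add: \<Psi>_eq_rot_dist)
  qed
  have "0 < (\<alpha> * C)\<^sup>2 / (2 - \<psi>)" "0 < 2 * \<beta>"
    using pos C(1) \<psi> by auto
  then show thesis
    using pos bounds by (intro that[of \<alpha> \<beta> "(\<alpha> * C)\<^sup>2 / (2 - \<psi>)" "2 * \<beta>"])
      (simp_all only: conjunct1 conjunct2)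
qed

theorem proposition1:
  fixes J :: "real^3^3" and k\<^sub>R k\<^sub>\<Omega> :: real
    and Rd :: "real \<Rightarrow> real^3^3" and \<Omega>d :: "real \<Rightarrow> real^3"
  assumes "sym_pos_def J" and "k\<^sub>R > 0" and "k\<^sub>\<Omega> > 0"
    and "attitude_command Rd \<Omega>d"
  shows "exp_stable J k\<^sub>R k\<^sub>\<Omega> Rd \<Omega>d (initial_region J k\<^sub>R (Rd 0) (\<Omega>d 0)) \<and>
    (\<forall>K. compact K \<and> K \<subseteq> initial_region J k\<^sub>R (Rd 0) (\<Omega>d 0) \<longrightarrow>
      (\<exists>\<alpha>\<^sub>2>0. \<exists>\<beta>\<^sub>2>0. \<forall>R \<Omega>. closed_loop J k\<^sub>R k\<^sub>\<Omega> Rd \<Omega>d R \<Omega> \<and> (R 0, \<Omega> 0) \<in> K \<longrightarrow>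
        (\<forall>t\<ge>0. \<Psi> (R t) (Rd t) \<le> min 2 (\<alpha>\<^sub>2 * exp (- \<beta>\<^sub>2 * t)))))"
proof -
  let ?z = "\<lambda>R \<Omega> t. (e_R (R t) (Rd t), e_\<Omega> (R t) (\<Omega> t) (Rd t) (\<Omega>d t))"
  show ?thesis
    unfolding exp_stable_def Let_def
  proof (intro conjI allI impI; elim conjE)
    fix K
    assume K: "compact K" "K \<subseteq> initial_region J k\<^sub>R (Rd 0) (\<Omega>d 0)"
    obtain \<alpha> \<beta> \<alpha>\<^sub>2 \<beta>\<^sub>2 where pos: "0 < \<alpha>" "0 < \<beta>" "0 < \<alpha>\<^sub>2" "0 < \<beta>\<^sub>2"
      and bounds: "\<And>R \<Omega> t. closed_loop J k\<^sub>R k\<^sub>\<Omega> Rd \<Omega>d R \<Omega> \<Longrightarrow> (R 0, \<Omega> 0) \<in> K \<Longrightarrow> 0 \<le> t \<Longrightarrow>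
        norm (?z R \<Omega> t) \<le> \<alpha> * norm (?z R \<Omega> 0) * exp (- \<beta> * t)"
      "\<And>R \<Omega> t. closed_loop J k\<^sub>R k\<^sub>\<Omega> Rd \<Omega>d R \<Omega> \<Longrightarrow> (R 0, \<Omega> 0) \<in> K \<Longrightarrow> 0 \<le> t \<Longrightarrow>
        \<Psi> (R t) (Rd t) \<le> min 2 (\<alpha>\<^sub>2 * exp (- \<beta>\<^sub>2 * t))"
      by (rule closed_loop_uniform_bounds[OF assms K]) (rule that)
    show "\<exists>\<alpha>>0. \<exists>\<beta>>0. \<forall>R \<Omega>. closed_loop J k\<^sub>R k\<^sub>\<Omega> Rd \<Omega>d R \<Omega> \<and> (R 0, \<Omega> 0) \<in> K \<longrightarrow>
      (\<forall>t>0. norm (?z R \<Omega> t) \<le> \<alpha> * norm (?z R \<Omega> 0) * exp (- \<beta> * t))"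
      by (intro exI[of _ \<alpha>] exI[of _ \<beta>] conjI allI impI pos) (elim conjE, simp only: bounds less_imp_le)
    show "\<exists>\<alpha>\<^sub>2>0. \<exists>\<beta>\<^sub>2>0. \<forall>R \<Omega>. closed_loop J k\<^sub>R k\<^sub>\<Omega> Rd \<Omega>d R \<Omega> \<and> (R 0, \<Omega> 0) \<in> K \<longrightarrow>
      (\<forall>t\<ge>0. \<Psi> (R t) (Rd t) \<le> min 2 (\<alpha>\<^sub>2 * exp (- \<beta>\<^sub>2 * t)))"
      by (intro exI[of _ \<alpha>\<^sub>2] exI[of _ \<beta>\<^sub>2] conjI allI impI pos) (elim conjE, simp only: bounds)
  qed
qed

end
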